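(* Let $\mathcal{H}_A$ and $\mathcal{H}_B$ be complex Hilbert spaces with $\dim\mathcal{H}_A=r\ge 2$ and $\dim\mathcal{H}_B=s\ge 2$ (both finite), and let $\epsilon$ be a real number. Suppose there exists an $\epsilon$-approximate masker for all states in $\mathbb{P}(\mathcal{H}_A)$, i.e. there exist a unit vector $|b\rangle\in\mathcal{H}_B$ and a unitary operator $U$ on $\mathcal{H}_A\otimes\mathcal{H}_B$ such that, setting for each unit vector $|a\rangle\in\mathcal{H}_A$ $$|\Psi_a\rangle=U(|a\rangle\otimes|b\rangle),\qquad \rho_{A|a}=\operatorname{Tr}_B\big(|\Psi_a\rangle\langle\Psi_a|\big),\qquad \rho_{B|a}=\operatorname{Tr}_A\big(|\Psi_a\rangle\langle\Psi_a|\big),$$ one has, for all unit vectors $|a\rangle,|a'\rangle\in\mathcal{H}_A$, $$F(\rho_{A|a},\rho_{A|a'})\ge 1-\epsilon\quad\text{and}\quad F(\rho_{B|a},\rho_{B|a'})\ge 1-\epsilon .$$ Then $$\epsilon\;\ge\;\frac{\sqrt{2}}{72}\left(-1+\sqrt{1+\frac{36}{\min\{r,s\}}}\right).$$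
   Context: $\mathbb{P}(\mathcal{H})$ denotes the set of pure states (unit vectors) of a Hilbert space $\mathcal{H}$. $\operatorname{Tr}_A$ and $\operatorname{Tr}_B$ are the partial traces over $\mathcal{H}_A$ and $\mathcal{H}_B$. For density matrices $P,Q$, the quantum fidelity is $F(P,Q):=\operatorname{Tr}\sqrt{\sqrt{P}\,Q\,\sqrt{P}}$ (no square is taken). An $\epsilon$-approximate masker for a set of pure states in $\mathcal{H}_A$ is a unitary on $\mathcal{H}_A\otimes\mathcal{H}_B$, together with a fixed pure ancilla state $|b\rangle$, for which the marginals of the output states on each of the two subsystems have pairwise fidelity at least $1-\epsilon$. *)

theory Defs
  imports "HOL-Analysis.Analysis"
begin

text \<open>
  An \<open>n\<close>-dimensional complex Hilbert space is \<open>complex ^ 'n\<close> with \<open>CARD('n) = n\<close>; its library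
  norm is the Hilbert-space norm. Operators are square matrices, and the tensor product of
  \<open>complex ^ 'a\<close> and \<open>complex ^ 'b\<close> is \<open>complex ^ ('a \<times> 'b)\<close>.
\<close>

definition pure_states :: "(complex ^ 'n) set"
  where "pure_states = {v. norm v = 1}"

text \<open>The library's inner product on \<open>complex ^ 'n\<close> is real-valued (the real part of this one).\<close>

definition cinner :: "complex ^ 'n \<Rightarrow> complex ^ 'n \<Rightarrow> complex"
  where "cinner v w = (\<Sum>i\<in>UNIV. cnj (v $ i) * w $ i)"

definition conj_transpose :: "complex ^ 'n ^ 'm \<Rightarrow> complex ^ 'm ^ 'n"
  where "conj_transpose M = (\<chi> i j. cnj (M $ j $ i))"

definition unitary :: "complex ^ 'n ^ 'n \<Rightarrow> bool"
  where "unitary U \<longleftrightarrow> conj_transpose U ** U = mat 1 \<and> U ** conj_transpose U = mat 1"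

text \<open>Over the complex numbers, this condition already forces \<open>P\<close> to be Hermitian.\<close>

definition positive_semidefinite :: "complex ^ 'n ^ 'n \<Rightarrow> bool"
  where "positive_semidefinite P \<longleftrightarrow> (\<forall>v. cinner v (P *v v) \<in> \<real>\<^sub>\<ge>\<^sub>0)"

text \<open>Meaningful for positive semidefinite \<open>P\<close>, where the square root exists and is unique.\<close>

definition matrix_sqrt :: "complex ^ 'n ^ 'n \<Rightarrow> complex ^ 'n ^ 'n"
  where "matrix_sqrt P = (THE S. positive_semidefinite S \<and> S ** S = P)"

text \<open>
  The fidelity without square. For density matrices the trace is a nonnegative real, so \<open>Re\<close>
  only changes its type.
\<close>

definition fidelity :: "complex ^ 'n ^ 'n \<Rightarrow> complex ^ 'n ^ 'n \<Rightarrow> real"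
  where "fidelity P Q = Re (trace (matrix_sqrt (matrix_sqrt P ** Q ** matrix_sqrt P)))"

definition tensor_vec :: "complex ^ 'a \<Rightarrow> complex ^ 'b \<Rightarrow> complex ^ ('a \<times> 'b)"
  where "tensor_vec v w = (\<chi> p. v $ fst p * w $ snd p)"

text \<open>The operator \<open>|v\<rangle>\<langle>v|\<close>.\<close>

definition ket_bra :: "complex ^ 'n \<Rightarrow> complex ^ 'n ^ 'n"
  where "ket_bra v = (\<chi> i j. v $ i * cnj (v $ j))"

definition partial_trace_A :: "complex ^ ('a::finite \<times> 'b::finite) ^ ('a \<times> 'b) \<Rightarrow> complex ^ 'b ^ 'b"
  where "partial_trace_A M = (\<chi> k l. \<Sum>i\<in>UNIV. M $ (i, k) $ (i, l))"

definition partial_trace_B :: "complex ^ ('a::finite \<times> 'b::finite) ^ ('a \<times> 'b) \<Rightarrow> complex ^ 'a ^ 'a"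
  where "partial_trace_B M = (\<chi> i j. \<Sum>k\<in>UNIV. M $ (i, k) $ (j, k))"

definition masked_state ::
    "complex ^ ('a::finite \<times> 'b::finite) ^ ('a \<times> 'b) \<Rightarrow> complex ^ 'b \<Rightarrow> complex ^ 'a \<Rightarrow> complex ^ ('a \<times> 'b)"
  where "masked_state U b a = U *v tensor_vec a b"

definition marginal_A ::
    "complex ^ ('a::finite \<times> 'b::finite) ^ ('a \<times> 'b) \<Rightarrow> complex ^ 'b \<Rightarrow> complex ^ 'a \<Rightarrow> complex ^ 'a ^ 'a"
  where "marginal_A U b a = partial_trace_B (ket_bra (masked_state U b a))"

definition marginal_B ::
    "complex ^ ('a::finite \<times> 'b::finite) ^ ('a \<times> 'b) \<Rightarrow> complex ^ 'b \<Rightarrow> complex ^ 'a \<Rightarrow> complex ^ 'b ^ 'b"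
  where "marginal_B U b a = partial_trace_A (ket_bra (masked_state U b a))"

definition approximate_masker ::
    "real \<Rightarrow> (complex ^ 'a) set \<Rightarrow> complex ^ ('a::finite \<times> 'b::finite) ^ ('a \<times> 'b) \<Rightarrow> complex ^ 'b \<Rightarrow> bool"
  where "approximate_masker \<epsilon> S U b \<longleftrightarrow>
    unitary U \<and> b \<in> pure_states \<and>
    (\<forall>a\<in>S. \<forall>a'\<in>S.
      fidelity (marginal_A U b a) (marginal_A U b a') \<ge> 1 - \<epsilon> \<and>
      fidelity (marginal_B U b a) (marginal_B U b a') \<ge> 1 - \<epsilon>)"

end

theory Submission
  imports Defs
begin

text \<open>
  View the output state \<open>\<Psi>\<^sub>a\<close> as an \<open>r \<times> s\<close> matrix \<open>M\<^sub>a\<close>, linear in \<open>a\<close>, so that the marginals are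
  \<open>\<rho>\<^sub>a = M\<^sub>a M\<^sub>a\<^sup>*\<close> and, up to transposition, \<open>\<sigma>\<^sub>a = M\<^sub>a\<^sup>* M\<^sub>a\<close>; all norms are Hilbert--Schmidt. If \<open>\<kappa>\<close>
  is the supremum of \<open>\<parallel>\<rho>\<^sub>a\<parallel> = \<parallel>\<sigma>\<^sub>a\<parallel>\<close>, then fidelity at least \<open>1 - \<epsilon>\<close> yields purifications at squared
  distance at most \<open>2\<epsilon>\<close> with operator norm at most \<open>\<surd>\<kappa>\<close>, hence any two marginals on the same side
  have squared distance at most \<open>8\<epsilon>\<kappa>\<close>. For orthogonal \<open>a\<close>, \<open>a'\<close>, polarization expresses
  \<open>M\<^sub>a\<^sup>* M\<^sub>a\<^sub>'\<close> by differences of the \<open>\<sigma>\<close>'s of four superpositions, so that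
  \<open>\<langle>\<rho>\<^sub>a, \<rho>\<^sub>a\<^sub>'\<rangle> = \<parallel>M\<^sub>a\<^sup>* M\<^sub>a\<^sub>'\<parallel>\<^sup>2 \<le> 4\<epsilon>\<kappa>\<close>. Therefore \<open>\<parallel>\<rho>\<^sub>a\<parallel>\<^sup>2 + \<parallel>\<rho>\<^sub>a\<^sub>'\<parallel>\<^sup>2 \<le> 16\<epsilon>\<kappa>\<close>. With \<open>d = min r s\<close>,
  each summand is at least \<open>1/d\<close>, and taking the supremum over \<open>a\<close> gives \<open>\<kappa>\<^sup>2 + 1/d \<le> 16\<epsilon>\<kappa>\<close>.
  Hence \<open>1/d \<le> 64\<epsilon>\<^sup>2\<close>, which is stronger than the claim.
\<close>

section \<open>Complex inner product, adjoints and the Hilbert--Schmidt norm\<close>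

lemma inner_eq_Re_cinner: "v \<bullet> w = Re (cinner v w)"
  by (simp add: inner_vec_def cinner_def inner_complex_def)

lemma cinner_self: "cinner v v = complex_of_real ((norm v)\<^sup>2)"
proof -
  have "cinner v v = (\<Sum>i\<in>UNIV. complex_of_real ((norm (v $ i))\<^sup>2))"
    unfolding cinner_def by (intro sum.cong refl) (metis complex_norm_square mult.commute)
  also have "\<dots> = complex_of_real ((norm v)\<^sup>2)"
    by (simp add: norm_vec_def L2_set_def sum_nonneg)
  finally show ?thesis .
qed

lemma cinner_add_left: "cinner (u + v) w = cinner u w + cinner v w"
  and cinner_add_right: "cinner u (v + w) = cinner u v + cinner u w"
  and cinner_diff_right: "cinner u (v - w) = cinner u v - cinner u w"
  and cinner_scale_left: "cinner (c *s u) v = cnj c * cinner u v"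
  and cinner_scale_right: "cinner u (c *s v) = c * cinner u v"
  and cinner_commute: "cinner u v = cnj (cinner v u)"
  by (simp_all add: cinner_def sum.distrib sum_subtractf sum_distrib_left algebra_simps)

lemma cinner_zero [simp]: "cinner 0 v = 0" "cinner v 0 = 0"
  by (simp_all add: cinner_def)

lemma norm_vector_scalar_mult: "norm (c *s v) = cmod c * norm (v :: complex ^ 'n)"
  by (simp add: norm_vec_def norm_mult L2_set_right_distrib)

lemma matrix_mult_diff_left: "(A - B) ** C = A ** C - B ** (C :: complex ^ 'n ^ 'm)"
  and matrix_mult_diff_right: "D ** (E - F) = D ** E - D ** (F :: complex ^ 'n ^ 'm)"
  and matrix_mult_add_left: "(A + B) ** C = A ** C + B ** C"
  by (simp_all add: matrix_matrix_mult_def vec_eq_iff sum_subtractf sum.distrib algebra_simps)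

lemma conj_transpose_mult: "conj_transpose (A ** B) = conj_transpose B ** conj_transpose A"
  by (simp add: conj_transpose_def matrix_matrix_mult_def vec_eq_iff mult.commute)

lemma conj_transpose_conj_transpose [simp]: "conj_transpose (conj_transpose A) = A"
  by (simp add: conj_transpose_def vec_eq_iff)

lemma conj_transpose_add: "conj_transpose (A + B) = conj_transpose A + conj_transpose B"
  and conj_transpose_diff: "conj_transpose (A - B) = conj_transpose A - conj_transpose B"
  and conj_transpose_mat_1 [simp]: "conj_transpose (mat 1) = mat 1"
  by (auto simp: conj_transpose_def vec_eq_iff mat_def)

lemma cinner_conj_transpose: "cinner v (A *v w) = cinner (conj_transpose A *v v) w"
  unfolding cinner_def conj_transpose_def matrix_vector_mult_def
  by (simp add: sum_distrib_left sum_distrib_right mult_ac) (rule sum.swap)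

lemma inner_eq_Re_trace:
  fixes A B :: "complex ^ 'n ^ 'm"
  shows "A \<bullet> B = Re (trace (conj_transpose A ** B))"
proof -
  have "Re (trace (conj_transpose A ** B)) = (\<Sum>j\<in>UNIV. \<Sum>i\<in>UNIV. A $ i $ j \<bullet> B $ i $ j)"
    by (simp add: trace_def conj_transpose_def matrix_matrix_mult_def inner_complex_def)
  also have "\<dots> = A \<bullet> B"
    unfolding inner_vec_def by (rule sum.swap)
  finally show ?thesis ..
qed

lemma norm_sq_eq_Re_trace: "(norm A)\<^sup>2 = Re (trace (conj_transpose A ** A))"
  by (simp add: power2_norm_eq_inner inner_eq_Re_trace)

lemma norm_conj_transpose [simp]: "norm (conj_transpose A) = norm A"
proof -
  have "(norm (conj_transpose A))\<^sup>2 = (norm A)\<^sup>2"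
    using trace_mul_sym[of A "conj_transpose A"] by (simp add: norm_sq_eq_Re_trace)
  then show ?thesis by simp
qed

lemma norm_gram_commute: "norm (conj_transpose A ** A) = norm (A ** conj_transpose A)"
proof -
  have "(norm (conj_transpose A ** A))\<^sup>2 = (norm (A ** conj_transpose A))\<^sup>2"
    unfolding norm_sq_eq_Re_trace
    using trace_mul_sym[of "conj_transpose A" "A ** conj_transpose A ** A"]
    by (simp add: conj_transpose_mult matrix_mul_assoc)
  then show ?thesis by simp
qed

lemma norm_sq_columns:
  fixes A :: "complex ^ 'n ^ 'm"
  shows "(norm A)\<^sup>2 = (\<Sum>j\<in>UNIV. (norm (column j A))\<^sup>2)"
proof -
  have "(norm A)\<^sup>2 = (\<Sum>i\<in>UNIV. \<Sum>j\<in>UNIV. (norm (A $ i $ j))\<^sup>2)"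
    by (simp add: norm_vec_def L2_set_def sum_nonneg)
  also have "\<dots> = (\<Sum>j\<in>UNIV. \<Sum>i\<in>UNIV. (norm (A $ i $ j))\<^sup>2)"
    by (rule sum.swap)
  also have "\<dots> = (\<Sum>j\<in>UNIV. (norm (column j A))\<^sup>2)"
    by (simp add: norm_vec_def L2_set_def sum_nonneg column_def)
  finally show ?thesis .
qed

lemma column_matrix_mult: "column j (A ** X) = A *v column j X"
  by (simp add: column_def matrix_matrix_mult_def matrix_vector_mult_def)

lemma matrix_vector_mult_axis: "A *v axis k 1 = column k (A :: complex ^ 'n ^ 'm)"
  by (simp add: matrix_vector_mult_def column_def axis_def vec_eq_iff
      if_distrib[of "\<lambda>x. _ * x"] cong: if_cong)

text \<open>Squared Hilbert--Schmidt norms add up over columns, so an operator bound on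
  \<open>A\<close> can be used on each column of \<open>X\<close>.\<close>

lemma norm_matrix_mult_le:
  fixes A :: "complex ^ 'n ^ 'm" and X :: "complex ^ 'k ^ 'n"
  assumes "0 \<le> c" and "\<And>v. norm (A *v v) \<le> c * norm v"
  shows "norm (A ** X) \<le> c * norm X"
proof -
  have "(norm (A ** X))\<^sup>2 \<le> (\<Sum>j\<in>UNIV. (c * norm (column j X))\<^sup>2)"
    unfolding norm_sq_columns column_matrix_mult
    by (intro sum_mono power_mono assms norm_ge_zero)
  also have "\<dots> = (c * norm X)\<^sup>2"
    by (simp add: norm_sq_columns power_mult_distrib sum_distrib_left)
  finally show ?thesis
    by (rule power2_le_imp_le) (simp add: assms(1))
qed

lemma norm_matrix_vector_mult_le:
  fixes A :: "complex ^ 'n ^ 'm"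
  shows "norm (A *v v) \<le> norm A * norm v"
proof -
  have "norm ((A *v v) $ i) \<le> norm (A $ i) * norm v" for i
  proof -
    have "norm ((A *v v) $ i) \<le> (\<Sum>j\<in>UNIV. \<bar>norm (A $ i $ j)\<bar> * \<bar>norm (v $ j)\<bar>)"
      unfolding matrix_vector_mult_def by (simp add: norm_mult sum_norm_le)
    also have "\<dots> \<le> norm (A $ i) * norm v"
      unfolding norm_vec_def by (rule L2_set_mult_ineq)
    finally show ?thesis .
  qed
  then have "norm (A *v v) \<le> L2_set (\<lambda>i. norm (A $ i) * norm v) UNIV"
    unfolding norm_vec_def[of "A *v v"] by (intro L2_set_mono) auto
  then show ?thesis
    by (simp add: L2_set_left_distrib norm_vec_def[of A])
qed

text \<open>Cauchy--Schwarz for the form of \<open>conj_transpose A ** A\<close> bounds the squared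
  operator norm of \<open>A\<close>; this is the source of the factor \<open>sqrt \<kappa>\<close>
  later.\<close>

lemma norm_matrix_vector_mult_sq_le:
  fixes A :: "complex ^ 'n ^ 'm"
  shows "(norm (A *v v))\<^sup>2 \<le> norm (A ** conj_transpose A) * (norm v)\<^sup>2"
proof -
  have "(norm (A *v v))\<^sup>2 = v \<bullet> ((conj_transpose A ** A) *v v)"
    by (simp add: power2_norm_eq_inner inner_eq_Re_cinner cinner_conj_transpose[of v "conj_transpose A"]
        matrix_vector_mul_assoc[symmetric])
  also have "\<dots> \<le> norm v * norm ((conj_transpose A ** A) *v v)"
    by (rule norm_cauchy_schwarz)
  also have "\<dots> \<le> norm v * (norm (conj_transpose A ** A) * norm v)"
    by (intro mult_left_mono norm_matrix_vector_mult_le norm_ge_zero)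
  finally show ?thesis
    by (simp add: norm_gram_commute power2_eq_square mult_ac)
qed

section \<open>Positive semidefinite matrices and uniqueness of their square roots\<close>

text \<open>Complex polarization: \<open>x + y\<close> kills the symmetric part of the sesquilinear
  form, \<open>x + \<i> *s y\<close> the antisymmetric part.\<close>

lemma cinner_form_zero_imp_zero:
  assumes "\<And>v. cinner v (D *v v) = 0"
  shows "D = 0"
proof -
  have "cinner x (D *v y) = 0" for x y
  proof -
    have 1: "cinner x (D *v y) + cinner y (D *v x) = 0"
      using assms[of "x + y"] assms[of x] assms[of y]
      by (simp add: matrix_vector_right_distrib cinner_add_left cinner_add_right add.commute)
    have "\<i> * cinner x (D *v y) - \<i> * cinner y (D *v x) = 0"
      using assms[of "x + \<i> *s y"] assms[of x] assms[of y]
      by (simp add: matrix_vector_right_distrib cinner_add_left cinner_add_right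
          cinner_scale_left cinner_scale_right vector_scalar_commute)
    then have "cinner x (D *v y) = cinner y (D *v x)"
      by simp
    with 1 show ?thesis by simp
  qed
  from this[of "D *v y" y for y] have "D *v y = 0" for y
    by (simp add: cinner_self)
  then show ?thesis
    by (simp add: matrix_eq)
qed

text \<open>A real quadratic form agrees with that of the adjoint, so the form of the difference
  vanishes.\<close>

lemma positive_semidefinite_hermitian:
  assumes "positive_semidefinite P"
  shows "conj_transpose P = P"
proof -
  have "cinner v ((conj_transpose P - P) *v v) = 0" for v
  proof -
    have "cinner v (P *v v) \<in> \<real>"
      using assms nonneg_Reals_subset_Reals by (auto simp: positive_semidefinite_def)
    then have "cinner (P *v v) v = cinner v (P *v v)"
      by (subst cinner_commute) (simp add: Reals_cnj_iff)
    then show ?thesis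
      by (simp add: matrix_vector_mult_diff_rdistrib cinner_diff_right cinner_conj_transpose[of _ "conj_transpose P"])
  qed
  then show ?thesis
    using cinner_form_zero_imp_zero[of "conj_transpose P - P"] by simp
qed

lemma positive_semidefinite_Re_nonneg:
  "positive_semidefinite P \<Longrightarrow> 0 \<le> Re (cinner v (P *v v))"
  by (auto simp: positive_semidefinite_def complex_nonneg_Reals_iff)

text \<open>A zero of a nonnegative form is a minimum, so the first-order change in the direction
  \<open>w = P *v v\<close>, twice the squared norm of \<open>w\<close>, must vanish.\<close>

lemma positive_semidefinite_kernel:
  assumes P: "positive_semidefinite P" and v: "Re (cinner v (P *v v)) = 0"
  shows "P *v v = 0"
proof -
  define w where "w = P *v v"
  define b where "b = Re (cinner w (P *v w))"
  have ge: "0 \<le> 2 * t * (norm w)\<^sup>2 + t\<^sup>2 * b" for t :: real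
  proof -
    let ?u = "v + complex_of_real t *s w"
    have "0 \<le> Re (cinner ?u (P *v ?u))"
      by (rule positive_semidefinite_Re_nonneg[OF P])
    moreover have "cinner v (P *v w) = cinner w w"
      by (simp add: w_def cinner_conj_transpose positive_semidefinite_hermitian[OF P])
    ultimately show ?thesis
      using v by (simp add: matrix_vector_right_distrib cinner_add_left cinner_add_right
          cinner_scale_left cinner_scale_right vector_scalar_commute b_def cinner_self
          w_def[symmetric] power2_eq_square algebra_simps)
  qed
  have b: "0 \<le> b"
    unfolding b_def by (rule positive_semidefinite_Re_nonneg[OF P])
  \<comment> \<open>Close to the minimizer of the quadratic in \<open>t\<close>; the
    \<open>+ 1\<close> keeps the denominator positive when \<open>b = 0\<close>.\<close>
  define t where "t = - (norm w)\<^sup>2 / (b + 1)"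
  have "2 * t * (norm w)\<^sup>2 + t\<^sup>2 * b = - ((norm w)\<^sup>2)\<^sup>2 * (b + 2) / (b + 1)\<^sup>2"
    using b by (simp add: t_def divide_simps power2_eq_square) (simp add: algebra_simps)
  with ge[of t] have "((norm w)\<^sup>2)\<^sup>2 * (b + 2) / (b + 1)\<^sup>2 \<le> 0"
    by simp
  then have "((norm w)\<^sup>2)\<^sup>2 \<le> 0"
    using b by (simp add: divide_le_0_iff mult_le_0_iff)
  then show ?thesis
    by (simp add: w_def)
qed

text \<open>With \<open>D = S - T\<close>, the hypothesis gives \<open>D (S + T) + (S + T) D = 0\<close>; taking the trace
  against \<open>D\<close> shows that \<open>D (S + T) D\<close> vanishes, so \<open>S D = T D = 0\<close> and \<open>D\<^sup>2 = 0\<close>.\<close>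

lemma positive_semidefinite_sqrt_unique:
  fixes S T :: "complex ^ 'n ^ 'n"
  assumes S: "positive_semidefinite S" and T: "positive_semidefinite T" and eq: "S ** S = T ** T"
  shows "S = T"
proof -
  define D where "D = S - T"
  have D: "conj_transpose D = D"
    by (simp add: D_def conj_transpose_diff positive_semidefinite_hermitian S T)
  have zero: "D ** (S + T) + (S + T) ** D = 0"
    unfolding D_def
    by (simp add: matrix_add_ldistrib matrix_mult_add_left matrix_mult_diff_left
        matrix_mult_diff_right eq)
  have "trace (D ** (D ** (S + T))) + trace (D ** ((S + T) ** D)) = 0"
    using arg_cong[OF zero, of "\<lambda>X. trace (D ** X)"]
    by (simp add: matrix_add_ldistrib trace_add) (simp add: trace_def)
  moreover have "trace (D ** (D ** (S + T))) = trace (D ** ((S + T) ** D))"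
    using trace_mul_sym[of D "D ** (S + T)"] by (simp add: matrix_mul_assoc)
  ultimately have tr: "trace (D ** ((S + T) ** D)) = 0"
    by simp
  define f where "f = (\<lambda>P i. Re (cinner (D *v axis i 1) (P *v (D *v axis i 1))))"
  have nonneg: "0 \<le> f S i" "0 \<le> f T i" for i
    unfolding f_def by (intro positive_semidefinite_Re_nonneg S T)+
  have axis: "M $ i $ i = cinner (axis i 1) (M *v axis i 1)" for M :: "complex ^ 'n ^ 'n" and i
    unfolding matrix_vector_mult_axis
    by (simp add: cinner_def column_def axis_def if_distrib[of cnj]
        if_distrib[of "\<lambda>x. x * _"] cong: if_cong)
  have "Re (trace (D ** ((S + T) ** D))) = (\<Sum>i\<in>UNIV. f S i + f T i)"
    unfolding trace_def axis f_def
    by (simp add: matrix_vector_mul_assoc[symmetric] cinner_conj_transpose[of _ D] D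
        matrix_vector_mult_add_rdistrib cinner_add_right)
  with tr have "\<forall>i\<in>UNIV. f S i + f T i = 0"
    using nonneg by (subst sum_nonneg_eq_0_iff[symmetric]) (auto intro: add_nonneg_nonneg)
  then have "f S i = 0 \<and> f T i = 0" for i
    using nonneg[of i] by (metis UNIV_I add_nonneg_eq_0_iff)
  then have "S *v (D *v axis i 1) = 0" "T *v (D *v axis i 1) = 0" for i
    using positive_semidefinite_kernel S T unfolding f_def by blast+
  then have "D *v (D *v axis i 1) = 0" for i
    by (subst (1) D_def) (simp add: matrix_vector_mult_diff_rdistrib)
  then have "cinner (axis i 1) (D *v (D *v axis i 1)) = 0" for i
    by simp
  then have "D *v axis i 1 = 0" for i
    by (simp add: cinner_conj_transpose[of _ D] D cinner_self)
  then have "D = 0"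
    by (simp add: matrix_vector_mult_axis column_def vec_eq_iff)
  then show ?thesis
    by (simp add: D_def)
qed

lemma matrix_sqrt_eqI:
  assumes "positive_semidefinite S" "S ** S = P"
  shows "matrix_sqrt P = S"
  unfolding matrix_sqrt_def
  by (rule the_equality) (use assms positive_semidefinite_sqrt_unique in auto)

section \<open>Rank-one operators\<close>

definition outer :: "complex ^ 'm \<Rightarrow> complex ^ 'n \<Rightarrow> complex ^ 'n ^ 'm"
  where "outer u v = (\<chi> i j. u $ i * cnj (v $ j))"

lemma outer_mult_outer: "outer u v ** outer x y = outer (cinner v x *s u) y"
  by (simp add: outer_def cinner_def matrix_matrix_mult_def vec_eq_iff sum_distrib_left
      sum_distrib_right mult_ac)

lemma matrix_mult_outer: "A ** outer u v = outer (A *v u) v"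
  by (simp add: outer_def matrix_matrix_mult_def matrix_vector_mult_def vec_eq_iff
      sum_distrib_left sum_distrib_right mult_ac)

lemma conj_transpose_outer: "conj_transpose (outer u v) = outer v u"
  by (simp add: outer_def conj_transpose_def vec_eq_iff mult.commute)

lemma outer_add_left: "outer (u + v) w = outer u w + outer v w"
  and outer_scale_right: "outer u (c *s v) = outer (cnj c *s u) v"
  and outer_zero_left [simp]: "outer 0 v = 0"
  and outer_zero_right [simp]: "outer v 0 = 0"
  by (simp_all add: outer_def vec_eq_iff algebra_simps)

lemma outer_mult_matrix: "outer u v ** A = outer u (conj_transpose A *v v)"
  by (simp add: outer_def conj_transpose_def matrix_matrix_mult_def matrix_vector_mult_def
      vec_eq_iff sum_distrib_left mult_ac)

lemma trace_outer: "trace (outer u v) = cinner v u"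
  by (simp add: trace_def outer_def cinner_def mult.commute)

lemma matrix_gram_eq_sum_outer: "M ** conj_transpose M = (\<Sum>k\<in>UNIV. outer (column k M) (column k M))"
  by (simp add: outer_def conj_transpose_def matrix_matrix_mult_def column_def vec_eq_iff)

section \<open>The unitary group and polar decomposition\<close>

lemma unitaryI: "conj_transpose U ** U = mat 1 \<Longrightarrow> unitary U"
  by (simp add: unitary_def matrix_left_right_inverse[of U])

lemma unitary_mult:
  assumes "unitary U" "unitary V"
  shows "unitary (U ** V)"
proof (rule unitaryI)
  have "conj_transpose (U ** V) ** (U ** V) = conj_transpose V ** (conj_transpose U ** U) ** V"
    by (simp add: conj_transpose_mult matrix_mul_assoc)
  then show "conj_transpose (U ** V) ** (U ** V) = mat 1"
    using assms by (simp add: unitary_def)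
qed

lemma norm_unitary_mult_vec:
  assumes "unitary U"
  shows "norm (U *v v) = norm v"
proof -
  have "cinner (U *v v) (U *v v) = cinner ((conj_transpose U ** U) *v v) v"
    by (simp add: cinner_conj_transpose[of "U *v v"] matrix_vector_mul_assoc)
  then have "cinner (U *v v) (U *v v) = cinner v v"
    using assms by (simp add: unitary_def)
  then have "(norm (U *v v))\<^sup>2 = (norm v)\<^sup>2"
    unfolding cinner_self of_real_eq_iff .
  then show ?thesis by simp
qed

text \<open>Supplies the maximizer for the polar decomposition: unitaries have constant norm, and
  orthonormality of the columns is a closed condition.\<close>

lemma compact_unitary: "compact {U :: complex ^ 'n ^ 'n. unitary U}"
proof -
  have "(norm U)\<^sup>2 = real CARD('n)" if "unitary U" for U :: "complex ^ 'n ^ 'n"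
    using that by (simp add: norm_sq_eq_Re_trace unitary_def trace_I)
  then have "bounded {U :: complex ^ 'n ^ 'n. unitary U}"
    by (intro boundedI[where B = "sqrt (real CARD('n))"]) (auto simp: real_le_rsqrt)
  moreover have "{U :: complex ^ 'n ^ 'n. unitary U} =
      {U. \<forall>i j. (\<Sum>k\<in>UNIV. cnj (U $ k $ i) * U $ k $ j) = (if i = j then 1 else 0)}"
  proof -
    have "unitary U \<longleftrightarrow> conj_transpose U ** U = mat 1" for U :: "complex ^ 'n ^ 'n"
      using unitaryI by (auto simp: unitary_def)
    then show ?thesis
      by (simp add: conj_transpose_def matrix_matrix_mult_def vec_eq_iff mat_def)
  qed
  moreover have "closed \<dots>"
    by (intro closed_Collect_all closed_Collect_eq continuous_intros)
  ultimately show ?thesis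
    by (simp add: compact_eq_bounded_closed)
qed

text \<open>The operator multiplies \<open>v\<close> by \<open>1 + c\<close> and fixes its
  orthogonal complement; the condition on \<open>c\<close> says that \<open>1 + c\<close> has
  modulus one.\<close>

lemma unitary_rank_one_perturbation:
  assumes "norm v = 1" "cnj c + c + cnj c * c = 0"
  shows "unitary (mat 1 + outer (c *s v) v)"
proof (rule unitaryI)
  have "outer ((cnj c + c + cnj c * c) *s v) v = 0"
    by (simp add: assms(2))
  then have "outer (cnj c *s v) v + outer (c *s v) v + outer ((cnj c * c) *s v) v = 0"
    by (simp only: vector_sadd_rdistrib outer_add_left)
  moreover have "cinner v v = 1"
    using assms(1) by (simp add: cinner_self)
  ultimately show "conj_transpose (mat 1 + outer (c *s v) v) ** (mat 1 + outer (c *s v) v) = mat 1"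
    by (simp add: conj_transpose_add conj_transpose_outer matrix_add_ldistrib matrix_mult_add_left
        outer_mult_outer outer_scale_right cinner_scale_left cinner_scale_right
        vector_smult_assoc mult_ac add_ac)
qed

text \<open>\<open>W\<close> maximises \<open>Re (trace (W\<^sup>* C))\<close> over the unitary group; comparing \<open>W\<close> with its
  modification by a phase in the direction of \<open>v\<close> shows that \<open>cinner v (W\<^sup>* C v)\<close> does not lose
  real part under any rotation, so it is a nonnegative real.\<close>

lemma polar_decomposition:
  fixes C :: "complex ^ 'n ^ 'n"
  obtains W where "unitary W" "positive_semidefinite (conj_transpose W ** C)"
proof -
  let ?K = "{U :: complex ^ 'n ^ 'n. unitary U}"
  have "unitary (mat 1 :: complex ^ 'n ^ 'n)"
    by (rule unitaryI) simp
  then have "?K \<noteq> {}" by blast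
  moreover have "continuous_on ?K (\<lambda>U. U \<bullet> C)"
    by (intro continuous_intros)
  ultimately obtain W where W: "unitary W" and max: "\<And>U. unitary U \<Longrightarrow> U \<bullet> C \<le> W \<bullet> C"
    using continuous_attains_sup[OF compact_unitary] by (metis mem_Collect_eq)
  define H where "H = conj_transpose W ** C"
  have unit: "cinner v (H *v v) \<in> \<real>\<^sub>\<ge>\<^sub>0" if v: "norm v = 1" for v
  proof -
    define z where "z = cinner v (H *v v)"
    have rot: "Re (\<omega> * z) \<le> Re z" if \<omega>: "cmod \<omega> = 1" for \<omega>
    proof -
      define c where "c = \<omega> - 1"
      \<comment> \<open>\<open>E\<close> carries \<open>cnj c\<close> because it enters through its
        adjoint; the trace then changes by \<open>c * z\<close>.\<close>
      define E where "E = mat 1 + outer (cnj c *s v) v"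
      have "\<omega> * cnj \<omega> = 1"
        using \<omega> by (metis complex_norm_square of_real_1 power_one)
      then have "unitary E"
        unfolding E_def by (intro unitary_rank_one_perturbation v) (simp add: c_def algebra_simps)
      then have "(W ** E) \<bullet> C \<le> W \<bullet> C"
        by (intro max unitary_mult W)
      moreover have "conj_transpose (W ** E) ** C = H + outer (c *s v) v ** H"
        by (simp add: E_def H_def conj_transpose_mult conj_transpose_add conj_transpose_outer
            matrix_mult_add_left outer_scale_right matrix_mul_assoc)
      then have "trace (conj_transpose (W ** E) ** C) = trace H + c * z"
        by (simp add: trace_add outer_mult_matrix trace_outer cinner_conj_transpose[of v H]
            cinner_scale_right z_def)
      ultimately show ?thesis
        by (simp add: inner_eq_Re_trace H_def c_def algebra_simps)
    qed
    have "cmod z \<le> Re z"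
    proof (cases "z = 0")
      case False
      then have "cmod (cnj z / complex_of_real (cmod z)) = 1"
        by (simp add: norm_divide)
      moreover have "cnj z / complex_of_real (cmod z) * z = complex_of_real (cmod z)"
        using False complex_norm_square[of z] by (simp add: divide_simps power2_eq_square mult.commute)
      ultimately show ?thesis
        using rot by (metis Re_complex_of_real)
    qed simp
    then show ?thesis
      using complex_Re_le_cmod[of z] cmod_eq_Re[of z]
      by (simp add: z_def[symmetric] complex_nonneg_Reals_iff)
         (smt (verit) abs_Re_le_cmod cmod_Re_le_iff cmod_power2 norm_ge_zero power2_eq_iff_nonneg zero_eq_power2)
  qed
  have "positive_semidefinite H"
    unfolding positive_semidefinite_def
  proof
    fix v
    show "cinner v (H *v v) \<in> \<real>\<^sub>\<ge>\<^sub>0"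
    proof (cases "v = 0")
      case False
      define u where "u = complex_of_real (1 / norm v) *s v"
      have "norm u = 1"
        using False by (simp add: u_def norm_vector_scalar_mult norm_divide)
      then have "cinner u (H *v u) \<in> \<real>\<^sub>\<ge>\<^sub>0"
        by (rule unit)
      moreover have "v = complex_of_real (norm v) *s u"
        using False by (simp add: u_def vector_smult_assoc)
      then have "cinner v (H *v v) = complex_of_real ((norm v)\<^sup>2) * cinner u (H *v u)"
        by (metis (no_types, lifting) cinner_scale_left cinner_scale_right complex_cnj_complex_of_real
            mult.assoc of_real_mult power2_eq_square vector_scalar_commute)
      ultimately show ?thesis
        by (simp only:) (intro nonneg_Reals_mult_I, auto)
    qed simp
  qed
  with W show ?thesis
    using that H_def by blast
qed

section \<open>Square factors of Gram matrices\<close>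

text \<open>If \<open>C\<close> is singular, \<open>v\<close> is placed along a unit kernel vector
  \<open>u\<close>, and the cross terms of \<open>C + outer v u\<close> vanish. If \<open>C\<close>
  is invertible, \<open>v = C *v w\<close>, and \<open>C\<close> is multiplied by a Hermitian root
  of \<open>mat 1 + outer w w\<close>.\<close>

lemma gram_rank_one_update:
  fixes C :: "complex ^ 'n ^ 'n"
  obtains C' :: "complex ^ 'n ^ 'n" where "C' ** conj_transpose C' = C ** conj_transpose C + outer v v"
proof (cases "\<exists>z. z \<noteq> 0 \<and> C *v z = 0")
  case True
  then obtain z where z: "z \<noteq> 0" "C *v z = 0" by blast
  define u where "u = complex_of_real (1 / norm z) *s z"
  have u: "cinner u u = 1" "C *v u = 0"
    using z by (simp_all add: u_def cinner_self norm_vector_scalar_mult norm_divide vector_scalar_commute)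
  have "(C + outer v u) ** conj_transpose (C + outer v u) = C ** conj_transpose C + outer v v"
    apply (simp only: conj_transpose_add conj_transpose_outer matrix_add_ldistrib matrix_mult_add_left
        outer_mult_outer u)
    by (simp add: matrix_mult_outer outer_mult_matrix u)
  then show ?thesis by (rule that)
next
  case False
  then obtain B where B: "B ** C = mat 1"
    using matrix_left_invertible_ker[of C] by blast
  then have CB: "C ** B = mat 1"
    by (simp add: matrix_left_right_inverse)
  define w where "w = B *v v"
  have Cw: "C *v w = v"
    by (simp add: w_def matrix_vector_mul_assoc CB)
  define n where "n = (norm w)\<^sup>2"
  \<comment> \<open>The positive solution of \<open>n * t\<^sup>2 + 2 * t = 1\<close>, rationalized
    so that it also covers \<open>n = 0\<close>.\<close>
  define t where "t = 1 / (1 + sqrt (1 + n))"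
  have n: "0 \<le> n" by (simp add: n_def)
  have t: "2 * t + t\<^sup>2 * n = 1"
  proof -
    define s where "s = sqrt (1 + n)"
    have "1 + s > 0" "n = s\<^sup>2 - 1"
      using n by (simp_all add: s_def add_pos_nonneg)
    then show ?thesis
      unfolding t_def s_def[symmetric]
      by (simp add: divide_simps power2_eq_square) (simp add: algebra_simps)
  qed
  define c where "c = complex_of_real t"
  define E where "E = mat 1 + outer (c *s w) w"
  have "cinner w w = complex_of_real n"
    by (simp only: cinner_self n_def)
  then have "c + c + c * c * cinner w w = complex_of_real (2 * t + t\<^sup>2 * n)"
    by (simp only: c_def mult_2 power2_eq_square of_real_add of_real_mult)
  then have c: "c + c + c * c * cinner w w = 1" "cnj c = c"
    by (simp_all only: t of_real_1 c_def complex_cnj_complex_of_real)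
  have "E ** conj_transpose E
      = mat 1 + (outer (c *s w) w + outer (c *s w) w + outer ((c * c * cinner w w) *s w) w)"
    by (simp add: E_def conj_transpose_add conj_transpose_outer matrix_add_ldistrib
        matrix_mult_add_left outer_mult_outer outer_scale_right cinner_scale_left
        cinner_scale_right vector_smult_assoc c(2) mult_ac add.assoc)
  also have "\<dots> = mat 1 + outer ((c + c + c * c * cinner w w) *s w) w"
    by (simp only: vector_sadd_rdistrib outer_add_left)
  finally have E: "E ** conj_transpose E = mat 1 + outer w w"
    by (simp only: c(1) vector_smult_lid)
  have "(C ** E) ** conj_transpose (C ** E) = C ** (E ** conj_transpose E) ** conj_transpose C"
    by (simp add: conj_transpose_mult matrix_mul_assoc)
  also have "\<dots> = C ** conj_transpose C + outer v v"
    by (simp add: E matrix_add_ldistrib matrix_mult_add_left matrix_mult_outer outer_mult_matrix Cw)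
  finally show ?thesis by (rule that)
qed

text \<open>Trades a rectangular factor for a square one, to which polar decomposition
  applies.\<close>

lemma sum_outer_eq_gram:
  fixes f :: "'k \<Rightarrow> complex ^ 'n"
  assumes "finite K"
  shows "\<exists>C :: complex ^ 'n ^ 'n. C ** conj_transpose C = (\<Sum>k\<in>K. outer (f k) (f k))"
  using assms
proof induction
  case empty
  show ?case
    by (rule exI[of _ 0]) simp
next
  case (insert k K)
  then obtain C :: "complex ^ 'n ^ 'n" where C: "C ** conj_transpose C = (\<Sum>k\<in>K. outer (f k) (f k))"
    by blast
  obtain C' :: "complex ^ 'n ^ 'n" where "C' ** conj_transpose C' = C ** conj_transpose C + outer (f k) (f k)"
    by (rule gram_rank_one_update)
  then show ?case
    using insert C by (auto simp: add.commute)
qed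

section \<open>Square roots and fidelity of Gram matrices\<close>

text \<open>The positive factor is Hermitian, so its square is its adjoint times itself, where
  \<open>W\<close> cancels.\<close>

lemma polar_sqrt:
  fixes C :: "complex ^ 'n ^ 'n"
  assumes "unitary W" "positive_semidefinite (conj_transpose W ** C)"
  shows "(conj_transpose W ** C) ** (conj_transpose W ** C) = conj_transpose C ** C"
proof -
  have "(conj_transpose W ** C) ** (conj_transpose W ** C)
      = conj_transpose (conj_transpose W ** C) ** (conj_transpose W ** C)"
    using positive_semidefinite_hermitian[OF assms(2)] by simp
  also have "\<dots> = conj_transpose C ** (W ** conj_transpose W) ** C"
    by (simp add: conj_transpose_mult matrix_mul_assoc)
  finally show ?thesis
    using assms(1) by (simp add: unitary_def)
qed

text \<open>Existence behind the definite description in \<open>matrix_sqrt\<close>: the root is the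
  positive polar factor of the adjoint of a square factor \<open>C\<close>.\<close>

lemma matrix_sqrt_gram:
  fixes M :: "complex ^ 'k ^ 'n"
  defines "S \<equiv> matrix_sqrt (M ** conj_transpose M)"
  shows "conj_transpose S = S" "S ** S = M ** conj_transpose M"
proof -
  obtain C :: "complex ^ 'n ^ 'n" where C: "C ** conj_transpose C = M ** conj_transpose M"
    using sum_outer_eq_gram[of UNIV "\<lambda>k. column k M"] by (auto simp: matrix_gram_eq_sum_outer)
  obtain W where W: "unitary W" "positive_semidefinite (conj_transpose W ** conj_transpose C)"
    by (rule polar_decomposition)
  from polar_sqrt[OF W] have sq: "(conj_transpose W ** conj_transpose C) ** (conj_transpose W ** conj_transpose C)
      = M ** conj_transpose M"
    by (simp add: C)
  then have "S = conj_transpose W ** conj_transpose C"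
    unfolding S_def by (rule matrix_sqrt_eqI[OF W(2)])
  then show "conj_transpose S = S" "S ** S = M ** conj_transpose M"
    using sq positive_semidefinite_hermitian[OF W(2)] by simp_all
qed

text \<open>Uhlmann's theorem, in the form needed: the fidelity is attained as an overlap of purifications.\<close>

lemma fidelity_gram_eq_overlap:
  fixes M :: "complex ^ 'k ^ 'n" and N :: "complex ^ 'l ^ 'n"
  obtains S Y :: "complex ^ 'n ^ 'n"
  where "S ** conj_transpose S = M ** conj_transpose M"
    and "Y ** conj_transpose Y = N ** conj_transpose N"
    and "fidelity (M ** conj_transpose M) (N ** conj_transpose N) = Y \<bullet> S"
proof -
  define S where "S = matrix_sqrt (M ** conj_transpose M)"
  define R where "R = matrix_sqrt (N ** conj_transpose N)"
  note S = matrix_sqrt_gram[of M, folded S_def]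
  note R = matrix_sqrt_gram[of N, folded R_def]
  \<comment> \<open>The positive factor of \<open>R ** S\<close> is the square root inside the
    fidelity; moving \<open>W\<close> onto \<open>R\<close> turns its trace into the overlap of
    \<open>S\<close> and \<open>R ** W\<close>.\<close>
  obtain W where W: "unitary W" "positive_semidefinite (conj_transpose W ** (R ** S))"
    by (rule polar_decomposition)
  have "(conj_transpose W ** (R ** S)) ** (conj_transpose W ** (R ** S))
      = S ** (R ** R) ** S"
    unfolding polar_sqrt[OF W] by (simp add: conj_transpose_mult S(1) R(1) matrix_mul_assoc)
  then have "matrix_sqrt (S ** (N ** conj_transpose N) ** S) = conj_transpose W ** (R ** S)"
    unfolding R by (rule matrix_sqrt_eqI[OF W(2)])
  then have "fidelity (M ** conj_transpose M) (N ** conj_transpose N) = (R ** W) \<bullet> S"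
    by (simp add: fidelity_def S_def[symmetric] inner_eq_Re_trace conj_transpose_mult R matrix_mul_assoc)
  moreover have "(R ** W) ** conj_transpose (R ** W) = R ** (W ** conj_transpose W) ** R"
    by (simp add: conj_transpose_mult R matrix_mul_assoc)
  then have "(R ** W) ** conj_transpose (R ** W) = N ** conj_transpose N"
    using W by (simp add: unitary_def R)
  ultimately show ?thesis
    using that S by metis
qed

text \<open>The difference of Gram matrices is the Hermitian part of a product of sum and difference
  of purifications: fidelity controls the difference in Hilbert--Schmidt norm,
  \<open>\<kappa>\<close> the sum in operator norm.\<close>

lemma norm_gram_diff_le:
  fixes M :: "complex ^ 'k ^ 'n" and N :: "complex ^ 'l ^ 'n"
  assumes fid: "fidelity (M ** conj_transpose M) (N ** conj_transpose N) \<ge> 1 - \<epsilon>"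
    and unit: "norm M = 1" "norm N = 1"
    and \<kappa>: "norm (M ** conj_transpose M) \<le> \<kappa>" "norm (N ** conj_transpose N) \<le> \<kappa>"
  shows "0 \<le> \<epsilon>"
    and "(norm (M ** conj_transpose M - N ** conj_transpose N))\<^sup>2 \<le> 8 * \<epsilon> * \<kappa>"
proof -
  obtain S Y :: "complex ^ 'n ^ 'n" where S: "S ** conj_transpose S = M ** conj_transpose M"
    and Y: "Y ** conj_transpose Y = N ** conj_transpose N"
    and F: "fidelity (M ** conj_transpose M) (N ** conj_transpose N) = Y \<bullet> S"
    by (rule fidelity_gram_eq_overlap)
  have tr: "(norm A)\<^sup>2 = Re (trace (A ** conj_transpose A))" for A :: "complex ^ 'c ^ 'd"
    using norm_sq_eq_Re_trace[of "conj_transpose A"] by simp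
  have "(norm S)\<^sup>2 = 1" "(norm Y)\<^sup>2 = 1"
    using unit tr[of M] tr[of N] by (simp_all add: tr S Y)
  \<comment> \<open>For unit \<open>S\<close> and \<open>Y\<close> the squared distance is
    \<open>2 - 2 * (Y \<bullet> S)\<close>.\<close>
  then have dist: "(norm (S - Y))\<^sup>2 \<le> 2 * \<epsilon>"
    using fid F by (simp add: power2_norm_eq_inner inner_diff_left inner_diff_right inner_commute)
  then show "0 \<le> \<epsilon>"
    using zero_le_power2[of "norm (S - Y)"] by linarith
  have \<kappa>0: "0 \<le> \<kappa>"
    using \<kappa>(1) norm_ge_zero order_trans by blast
  have bound: "norm (A *v v) \<le> sqrt \<kappa> * norm v"
    if "norm (A ** conj_transpose A) \<le> \<kappa>" for A :: "complex ^ 'n ^ 'n" and v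
  proof -
    have "(norm (A *v v))\<^sup>2 \<le> (sqrt \<kappa> * norm v)\<^sup>2"
      using norm_matrix_vector_mult_sq_le[of A v] mult_right_mono[OF that, of "(norm v)\<^sup>2"] \<kappa>0
      by (simp add: power_mult_distrib)
    then show ?thesis
      by (rule power2_le_imp_le) (simp add: \<kappa>0)
  qed
  have "norm ((S + Y) *v v) \<le> (2 * sqrt \<kappa>) * norm v" for v
    using norm_triangle_ineq[of "S *v v" "Y *v v"] bound[of S v] bound[of Y v] \<kappa> S Y
    by (simp add: matrix_vector_mult_add_rdistrib)
  then have X: "norm ((S + Y) ** conj_transpose (S - Y)) \<le> 2 * sqrt \<kappa> * norm (S - Y)"
    using norm_matrix_mult_le[of "2 * sqrt \<kappa>" "S + Y" "conj_transpose (S - Y)"] \<kappa>0 by simp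
  let ?X = "(S + Y) ** conj_transpose (S - Y)"
  \<comment> \<open>The mixed products of \<open>S\<close> and \<open>Y\<close> cancel between
    \<open>?X\<close> and its adjoint.\<close>
  have "2 *\<^sub>R (M ** conj_transpose M - N ** conj_transpose N) = ?X + conj_transpose ?X"
    unfolding S[symmetric] Y[symmetric]
    by (simp add: conj_transpose_mult conj_transpose_diff conj_transpose_add matrix_mult_add_left
        matrix_mult_diff_left matrix_add_ldistrib matrix_mult_diff_right scaleR_2)
  then have "2 * norm (M ** conj_transpose M - N ** conj_transpose N) = norm (?X + conj_transpose ?X)"
    by (metis abs_numeral norm_scaleR)
  also have "\<dots> \<le> 2 * norm ?X"
    using norm_triangle_ineq[of ?X "conj_transpose ?X"] by simp
  finally have "norm (M ** conj_transpose M - N ** conj_transpose N) \<le> 2 * sqrt \<kappa> * norm (S - Y)"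
    using X by simp
  then have "(norm (M ** conj_transpose M - N ** conj_transpose N))\<^sup>2 \<le> (2 * sqrt \<kappa> * norm (S - Y))\<^sup>2"
    by (intro power_mono) simp_all
  also have "\<dots> = 4 * \<kappa> * (norm (S - Y))\<^sup>2"
    using \<kappa>0 by (simp add: power_mult_distrib)
  also have "\<dots> \<le> 4 * \<kappa> * (2 * \<epsilon>)"
    by (intro mult_left_mono dist) (simp add: \<kappa>0)
  finally show "(norm (M ** conj_transpose M - N ** conj_transpose N))\<^sup>2 \<le> 8 * \<epsilon> * \<kappa>"
    by (simp add: mult_ac)
qed

section \<open>Norm identities and polarization for Gram matrices\<close>

lemma norm_matrix_cong:
  fixes A B :: "complex ^ 'n ^ 'm"
  assumes "\<And>i j. cmod (A $ i $ j) = cmod (B $ i $ j)"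
  shows "norm A = norm B"
  by (simp add: norm_vec_def assms)

lemma inner_gram_gram:
  "(A ** conj_transpose A) \<bullet> (B ** conj_transpose B) = (norm (conj_transpose A ** B))\<^sup>2"
proof -
  have "trace (A ** conj_transpose A ** (B ** conj_transpose B))
      = trace (conj_transpose B ** A ** (conj_transpose A ** B))"
    using trace_mul_sym[of "A ** conj_transpose A ** B" "conj_transpose B"]
    by (simp add: matrix_mul_assoc)
  then show ?thesis
    by (simp add: inner_eq_Re_trace norm_sq_eq_Re_trace conj_transpose_mult)
qed

text \<open>The two matrices are entrywise conjugate. This carries norms from one subsystem to the
  other.\<close>

lemma norm_gram_transpose:
  "norm (transpose A ** conj_transpose (transpose B)) = norm (conj_transpose A ** B)"
proof (rule norm_matrix_cong)
  fix k l
  have "(transpose A ** conj_transpose (transpose B)) $ k $ l = cnj ((conj_transpose A ** B) $ k $ l)"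
    by (simp add: transpose_def conj_transpose_def matrix_matrix_mult_def)
  then show "cmod ((transpose A ** conj_transpose (transpose B)) $ k $ l)
      = cmod ((conj_transpose A ** B) $ k $ l)"
    by simp
qed

lemma norm_transpose: "norm (transpose A) = norm (A :: complex ^ 'n ^ 'm)"
proof -
  have "norm (transpose A) = norm (conj_transpose A)"
    by (rule norm_matrix_cong) (simp add: transpose_def conj_transpose_def)
  then show ?thesis by simp
qed

text \<open>Cauchy--Schwarz against the identity, whose squared norm is the dimension, for a Gram
  matrix of trace one.\<close>

lemma norm_gram_ge:
  fixes M :: "complex ^ 'k ^ 'n"
  assumes "norm M = 1"
  shows "1 / real CARD('n) \<le> (norm (M ** conj_transpose M))\<^sup>2"
proof -
  let ?P = "M ** conj_transpose M"
  have "(mat 1 :: complex ^ 'n ^ 'n) \<bullet> ?P = 1"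
    using norm_sq_eq_Re_trace[of "conj_transpose M"] assms by (simp add: inner_eq_Re_trace)
  then have "1 \<le> norm (mat 1 :: complex ^ 'n ^ 'n) * norm ?P"
    using norm_cauchy_schwarz by metis
  then have "1 \<le> (norm (mat 1 :: complex ^ 'n ^ 'n) * norm ?P)\<^sup>2"
    by (simp add: one_le_power)
  also have "\<dots> = real CARD('n) * (norm ?P)\<^sup>2"
    by (simp add: power_mult_distrib norm_sq_eq_Re_trace[of "mat 1"] trace_I)
  finally show ?thesis
    by (simp add: divide_le_eq mult.commute)
qed

lemma norm_gram_le_1:
  fixes M :: "complex ^ 'k ^ 'n"
  assumes "norm M = 1"
  shows "norm (M ** conj_transpose M) \<le> 1"
  using norm_matrix_mult_le[of "norm M" M "conj_transpose M"] norm_matrix_vector_mult_le[of M] assms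
  by simp

text \<open>With \<open>X = A ** conj_transpose B\<close>, the Gram matrices of \<open>A\<close> and
  \<open>B\<close> cancel in both differences, leaving \<open>X + conj_transpose X\<close> and, up
  to a phase, \<open>X - conj_transpose X\<close>. The parallelogram law finishes.\<close>

lemma gram_polarization:
  fixes A B :: "complex ^ 'k ^ 'n" and L :: "complex \<Rightarrow> complex ^ 'k ^ 'n"
  assumes L: "\<And>\<omega> i j. L \<omega> $ i $ j = (A $ i $ j + \<omega> * B $ i $ j) / complex_of_real (sqrt 2)"
  defines "\<sigma> \<equiv> \<lambda>\<omega>. L \<omega> ** conj_transpose (L \<omega>)"
  shows "4 * (norm (A ** conj_transpose B))\<^sup>2 = (norm (\<sigma> 1 - \<sigma> (- 1)))\<^sup>2 + (norm (\<sigma> \<i> - \<sigma> (- \<i>)))\<^sup>2"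
proof -
  define X where "X = A ** conj_transpose B"
  have sqrt2: "complex_of_real (sqrt 2) * complex_of_real (sqrt 2) = 2"
    by (simp flip: of_real_mult)
  have \<sigma>: "\<sigma> \<omega> $ i $ j = (\<Sum>k\<in>UNIV. (A $ i $ k + \<omega> * B $ i $ k) * cnj (A $ j $ k + \<omega> * B $ j $ k) / 2)" for \<omega> i j
    by (simp add: \<sigma>_def conj_transpose_def matrix_matrix_mult_def L sqrt2)
  have X: "X $ i $ j = (\<Sum>k\<in>UNIV. A $ i $ k * cnj (B $ j $ k))"
    "conj_transpose X $ i $ j = (\<Sum>k\<in>UNIV. B $ i $ k * cnj (A $ j $ k))" for i j
    by (simp_all add: X_def conj_transpose_def matrix_matrix_mult_def mult.commute)
  have "(\<sigma> 1 - \<sigma> (- 1)) $ i $ j = (X + conj_transpose X) $ i $ j" for i j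
    unfolding vector_minus_component vector_add_component \<sigma> X sum_subtractf[symmetric] sum.distrib[symmetric]
    by (intro sum.cong refl) (simp add: field_simps)
  then have 1: "norm (\<sigma> 1 - \<sigma> (- 1)) = norm (X + conj_transpose X)"
    by (intro norm_matrix_cong) simp
  have "(\<sigma> \<i> - \<sigma> (- \<i>)) $ i $ j = - \<i> * (X - conj_transpose X) $ i $ j" for i j
    unfolding vector_minus_component \<sigma> X sum_subtractf[symmetric] sum_distrib_left
    by (intro sum.cong refl) (simp add: field_simps)
  then have 2: "norm (\<sigma> \<i> - \<sigma> (- \<i>)) = norm (X - conj_transpose X)"
    by (intro norm_matrix_cong) (simp add: norm_mult)
  have "(norm (X + conj_transpose X))\<^sup>2 + (norm (X - conj_transpose X))\<^sup>2
      = 2 * (norm X)\<^sup>2 + 2 * (norm (conj_transpose X))\<^sup>2"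
    unfolding power2_norm_eq_inner by (simp add: inner_diff inner_add algebra_simps)
  then show ?thesis
    unfolding 1 2 X_def[symmetric] by simp
qed

section \<open>Orthogonal pure states and their superpositions\<close>

lemma exists_orthogonal_pure_state:
  fixes a :: "complex ^ 'n"
  assumes "CARD('n) \<ge> 2" "a \<in> pure_states"
  obtains a' where "a' \<in> pure_states" "cinner a a' = 0"
proof -
  have "a \<noteq> 0"
    using assms(2) by (auto simp: pure_states_def)
  then obtain i where i: "a $ i \<noteq> 0"
    by (auto simp: vec_eq_iff)
  have "\<not> UNIV \<subseteq> {i}"
    using assms(1) card_mono[of "{i}" "UNIV :: 'n set"] by auto
  then obtain j where j: "j \<noteq> i" by blast
  \<comment> \<open>Orthogonal to \<open>a\<close> within the coordinates \<open>i\<close> and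
    \<open>j\<close>, and nonzero at \<open>j\<close> because \<open>a $ i\<close> is
    nonzero.\<close>
  define x where "x = (\<chi> k. if k = i then cnj (a $ j) else if k = j then - cnj (a $ i) else 0)"
  have "x $ j \<noteq> 0"
    using i j by (simp add: x_def)
  then have x0: "x \<noteq> 0" by auto
  have "cinner a x = (\<Sum>k\<in>{i, j}. cnj (a $ k) * x $ k)"
    unfolding cinner_def by (rule sum.mono_neutral_right) (auto simp: x_def)
  then have x: "cinner a x = 0"
    using j by (simp add: x_def)
  show ?thesis
  proof
    show "complex_of_real (1 / norm x) *s x \<in> pure_states"
      using x0 by (simp add: pure_states_def norm_vector_scalar_mult norm_divide)
    show "cinner a (complex_of_real (1 / norm x) *s x) = 0"
      by (simp add: cinner_scale_right x)
  qed
qed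

lemma superposition_pure_state:
  assumes "a \<in> pure_states" "a' \<in> pure_states" "cinner a a' = 0" "cmod \<omega> = 1"
  shows "complex_of_real (1 / sqrt 2) *s (a + \<omega> *s a') \<in> pure_states"
proof -
  have "cinner a' a = 0"
    by (subst cinner_commute) (simp add: assms)
  moreover have "\<omega> * cnj \<omega> = 1"
    using assms(4) by (metis complex_norm_square of_real_1 power_one)
  ultimately have "cinner (a + \<omega> *s a') (a + \<omega> *s a') = 2"
    unfolding cinner_add_left cinner_add_right cinner_scale_left cinner_scale_right
    using assms by (simp add: cinner_self pure_states_def mult.commute)
  then have "(norm (a + \<omega> *s a'))\<^sup>2 = 2"
    unfolding cinner_self by (metis of_real_eq_iff of_real_numeral)
  then have "norm (a + \<omega> *s a') = sqrt 2"
    by (simp add: real_sqrt_unique)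
  then show ?thesis
    unfolding pure_states_def mem_Collect_eq norm_vector_scalar_mult by (simp add: norm_divide)
qed

section \<open>Bipartite states as matrices\<close>

definition coefficient_matrix :: "complex ^ ('a \<times> 'b) \<Rightarrow> complex ^ 'b ^ 'a"
  where "coefficient_matrix \<psi> = (\<chi> i k. \<psi> $ (i, k))"

lemma norm_coefficient_matrix: "norm (coefficient_matrix \<psi>) = norm \<psi>"
proof -
  have "(norm (coefficient_matrix \<psi>))\<^sup>2 = (\<Sum>i\<in>UNIV. \<Sum>k\<in>UNIV. (norm (\<psi> $ (i, k)))\<^sup>2)"
    by (simp add: norm_vec_def L2_set_def sum_nonneg coefficient_matrix_def)
  also have "\<dots> = (\<Sum>p\<in>UNIV. (norm (\<psi> $ p))\<^sup>2)"
    by (simp add: sum.cartesian_product)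
  also have "\<dots> = (norm \<psi>)\<^sup>2"
    by (simp add: norm_vec_def L2_set_def sum_nonneg)
  finally show ?thesis by simp
qed

text \<open>Taking the second marginal as the Gram matrix of the transposed coefficients lets the
  same lemmas serve both subsystems.\<close>

lemma partial_traces_ket_bra:
  "partial_trace_B (ket_bra \<psi>) = coefficient_matrix \<psi> ** conj_transpose (coefficient_matrix \<psi>)"
  "partial_trace_A (ket_bra \<psi>)
    = transpose (coefficient_matrix \<psi>) ** conj_transpose (transpose (coefficient_matrix \<psi>))"
  by (simp_all add: partial_trace_A_def partial_trace_B_def ket_bra_def coefficient_matrix_def
      conj_transpose_def transpose_def matrix_matrix_mult_def)

lemma norm_tensor_vec: "norm (tensor_vec v w) = norm v * norm w"
proof -
  have "(norm (tensor_vec v w))\<^sup>2 = (\<Sum>i\<in>UNIV. \<Sum>k\<in>UNIV. (norm (v $ i * w $ k))\<^sup>2)"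
    by (simp add: norm_vec_def L2_set_def sum_nonneg tensor_vec_def sum.cartesian_product case_prod_unfold)
  also have "\<dots> = (norm v * norm w)\<^sup>2"
    by (simp add: norm_vec_def L2_set_def sum_nonneg norm_mult power_mult_distrib sum_product)
  finally show ?thesis by simp
qed

lemma norm_masked_state:
  assumes "unitary U" "b \<in> pure_states" "a \<in> pure_states"
  shows "norm (masked_state U b a) = 1"
  using assms by (simp add: masked_state_def norm_unitary_mult_vec norm_tensor_vec pure_states_def)

lemma masked_state_superposition:
  "masked_state U b (c *s (a + \<omega> *s a')) $ p = c * (masked_state U b a $ p + \<omega> * masked_state U b a' $ p)"
proof -
  have "tensor_vec (c *s (a + \<omega> *s a')) b = c *s (tensor_vec a b + \<omega> *s tensor_vec a' b)"
    by (simp add: tensor_vec_def vec_eq_iff algebra_simps)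
  then show ?thesis
    by (simp add: masked_state_def vector_scalar_commute matrix_vector_right_distrib algebra_simps)
qed

section \<open>Bounds for approximate maskers\<close>

text \<open>Closeness of the second marginals on superpositions bounds the overlap of the first
  marginals of orthogonal inputs; as these are also close to each other, both must be small.\<close>

lemma approximate_masker_orthogonal_bound:
  assumes masker: "approximate_masker \<epsilon> pure_states U b"
    and a: "a \<in> pure_states" "a' \<in> pure_states" "cinner a a' = 0"
    and \<kappa>: "\<And>x. x \<in> pure_states \<Longrightarrow> norm (marginal_A U b x) \<le> \<kappa>"
  shows "0 \<le> \<epsilon>"
    and "(norm (marginal_A U b a))\<^sup>2 + (norm (marginal_A U b a'))\<^sup>2 \<le> 16 * \<epsilon> * \<kappa>"
proof -
  define K where "K = (\<lambda>x. coefficient_matrix (masked_state U b x))"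
  have A: "marginal_A U b x = K x ** conj_transpose (K x)"
    and B: "marginal_B U b x = transpose (K x) ** conj_transpose (transpose (K x))" for x
    by (simp_all add: marginal_A_def marginal_B_def partial_traces_ket_bra K_def)
  \<comment> \<open>Hence the single bound \<open>\<kappa>\<close> serves both subsystems.\<close>
  have norm_B: "norm (marginal_B U b x) = norm (marginal_A U b x)" for x
    by (simp add: A B norm_gram_transpose norm_gram_commute)
  have unit: "norm (K x) = 1" if "x \<in> pure_states" for x
    using masker that by (simp add: K_def norm_coefficient_matrix norm_masked_state approximate_masker_def)
  have diff_A: "(norm (marginal_A U b x - marginal_A U b y))\<^sup>2 \<le> 8 * \<epsilon> * \<kappa>"
    and diff_B: "(norm (marginal_B U b x - marginal_B U b y))\<^sup>2 \<le> 8 * \<epsilon> * \<kappa>"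
    and nonneg: "0 \<le> \<epsilon>"
    if "x \<in> pure_states" "y \<in> pure_states" for x y
  proof -
    have fid: "fidelity (marginal_A U b x) (marginal_A U b y) \<ge> 1 - \<epsilon>"
      "fidelity (marginal_B U b x) (marginal_B U b y) \<ge> 1 - \<epsilon>"
      using masker that by (simp_all add: approximate_masker_def)
    show "(norm (marginal_A U b x - marginal_A U b y))\<^sup>2 \<le> 8 * \<epsilon> * \<kappa>" "0 \<le> \<epsilon>"
      using norm_gram_diff_le[OF fid(1)[unfolded A] unit unit \<kappa>[unfolded A] \<kappa>[unfolded A]] that
      by (simp_all add: A)
    show "(norm (marginal_B U b x - marginal_B U b y))\<^sup>2 \<le> 8 * \<epsilon> * \<kappa>"
      using norm_gram_diff_le(2)[OF fid(2)[unfolded B], of \<kappa>] that unit \<kappa> norm_B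
      by (simp add: B norm_transpose)
  qed
  show "0 \<le> \<epsilon>"
    using nonneg a by blast
  define s where "s = (\<lambda>\<omega>. complex_of_real (1 / sqrt 2) *s (a + \<omega> *s a'))"
  have s: "s \<omega> \<in> pure_states" if "cmod \<omega> = 1" for \<omega>
    unfolding s_def by (intro superposition_pure_state a that)
  \<comment> \<open>The left side is four times the overlap of the first marginals, by
    \<open>norm_gram_transpose\<close> and \<open>inner_gram_gram\<close>.\<close>
  have "4 * (norm (transpose (K a) ** conj_transpose (transpose (K a'))))\<^sup>2
      = (norm (marginal_B U b (s 1) - marginal_B U b (s (- 1))))\<^sup>2
        + (norm (marginal_B U b (s \<i>) - marginal_B U b (s (- \<i>))))\<^sup>2"
    unfolding B
  proof (rule gram_polarization)
    fix \<omega> i j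
    show "transpose (K (s \<omega>)) $ i $ j
        = (transpose (K a) $ i $ j + \<omega> * transpose (K a') $ i $ j) / complex_of_real (sqrt 2)"
      unfolding transpose_def K_def coefficient_matrix_def s_def vec_lambda_beta masked_state_superposition
      by simp
  qed
  also have "\<dots> \<le> 8 * \<epsilon> * \<kappa> + 8 * \<epsilon> * \<kappa>"
    by (intro add_mono diff_B s) simp_all
  finally have "marginal_A U b a \<bullet> marginal_A U b a' \<le> 4 * \<epsilon> * \<kappa>"
    unfolding A inner_gram_gram norm_gram_transpose by simp
  \<comment> \<open>The constant 16 is 8 from the distance plus twice 4 from the overlap.\<close>
  moreover have "(norm (marginal_A U b a))\<^sup>2 + (norm (marginal_A U b a'))\<^sup>2
      = (norm (marginal_A U b a - marginal_A U b a'))\<^sup>2 + 2 * (marginal_A U b a \<bullet> marginal_A U b a')"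
    by (simp add: power2_norm_eq_inner inner_diff_left inner_diff_right inner_commute)
  ultimately show "(norm (marginal_A U b a))\<^sup>2 + (norm (marginal_A U b a'))\<^sup>2 \<le> 16 * \<epsilon> * \<kappa>"
    using diff_A[OF a(1,2)] by linarith
qed

text \<open>The smaller dimension appears because \<open>M\<close> and its transpose have Gram
  matrices of equal norm. The upper bound makes the supremum over inputs finite.\<close>

lemma norm_marginal_A_bounds:
  fixes U :: "complex ^ ('a::finite \<times> 'b::finite) ^ ('a \<times> 'b)"
  assumes "unitary U" "b \<in> pure_states" "a \<in> pure_states"
  shows "1 / real (min CARD('a) CARD('b)) \<le> (norm (marginal_A U b a))\<^sup>2"
    and "norm (marginal_A U b a) \<le> 1"
proof -
  define M where "M = coefficient_matrix (masked_state U b a)"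
  have M: "norm M = 1" "norm (transpose M) = 1"
    using assms by (simp_all add: M_def norm_transpose norm_coefficient_matrix norm_masked_state)
  have A: "marginal_A U b a = M ** conj_transpose M"
    by (simp add: marginal_A_def partial_traces_ket_bra M_def)
  have "norm (transpose M ** conj_transpose (transpose M)) = norm (M ** conj_transpose M)"
    by (simp add: norm_gram_transpose norm_gram_commute)
  then show "1 / real (min CARD('a) CARD('b)) \<le> (norm (marginal_A U b a))\<^sup>2"
    using norm_gram_ge[OF M(1)] norm_gram_ge[OF M(2)] by (simp add: A min_def)
  show "norm (marginal_A U b a) \<le> 1"
    unfolding A by (rule norm_gram_le_1[OF M(1)])
qed

text \<open>The orthogonal partner contributes its lower bound \<open>\<delta>\<close>, the other
  state the supremum, so \<open>\<kappa>\<close> satisfies a quadratic inequality.\<close>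

lemma approximate_masker_dimension_bound:
  fixes U :: "complex ^ ('a::finite \<times> 'b::finite) ^ ('a \<times> 'b)"
  assumes dim: "CARD('a) \<ge> 2" and masker: "approximate_masker \<epsilon> pure_states U b"
  shows "0 \<le> \<epsilon>" and "1 / real (min CARD('a) CARD('b)) \<le> 64 * \<epsilon>\<^sup>2"
proof -
  let ?S = "pure_states :: (complex ^ 'a) set"
  let ?f = "\<lambda>a. norm (marginal_A U b a)"
  define \<delta> where "\<delta> = 1 / real (min CARD('a) CARD('b))"
  have U: "unitary U" "b \<in> pure_states"
    using masker by (simp_all add: approximate_masker_def)
  define \<kappa> where "\<kappa> = (SUP a\<in>?S. ?f a)"
  have bdd: "bdd_above (?f ` ?S)"
    using norm_marginal_A_bounds(2)[OF U] by (auto intro!: bdd_aboveI[where M = 1])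
  then have \<kappa>: "?f a \<le> \<kappa>" if "a \<in> ?S" for a
    unfolding \<kappa>_def using that by (rule cSUP_upper2) simp
  obtain x :: "complex ^ 'a" where "norm x = 1"
    by (rule vector_choose_size[of 1]) simp
  then have ne: "?S \<noteq> {}"
    by (auto simp: pure_states_def)
  have main: "0 \<le> \<epsilon>" "(?f a)\<^sup>2 \<le> 16 * \<epsilon> * \<kappa> - \<delta>" if a: "a \<in> ?S" for a
  proof -
    obtain a' where a': "a' \<in> ?S" "cinner a a' = 0"
      by (rule exists_orthogonal_pure_state[OF dim a])
    show "0 \<le> \<epsilon>" "(?f a)\<^sup>2 \<le> 16 * \<epsilon> * \<kappa> - \<delta>"
      using approximate_masker_orthogonal_bound[OF masker a a' \<kappa>] norm_marginal_A_bounds(1)[OF U a'(1)]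
      by (simp_all add: \<delta>_def)
  qed
  show "0 \<le> \<epsilon>"
    using main ne by blast
  have "\<kappa> \<le> sqrt (16 * \<epsilon> * \<kappa> - \<delta>)"
    unfolding \<kappa>_def by (rule cSUP_least[OF ne]) (use main(2) in \<open>simp add: \<kappa>_def real_le_rsqrt\<close>)
  moreover have "0 \<le> \<kappa>" "0 \<le> 16 * \<epsilon> * \<kappa> - \<delta>"
    using ne \<kappa> main(2) by (meson all_not_in_conv norm_ge_zero zero_le_power2 order_trans)+
  ultimately have "\<kappa>\<^sup>2 \<le> 16 * \<epsilon> * \<kappa> - \<delta>"
    using power_mono[of \<kappa> "sqrt (16 * \<epsilon> * \<kappa> - \<delta>)" 2] by simp
  \<comment> \<open>Completing the square eliminates \<open>\<kappa>\<close>.\<close>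
  moreover have "0 \<le> (\<kappa> - 8 * \<epsilon>)\<^sup>2"
    by simp
  ultimately have "\<delta> \<le> 64 * \<epsilon>\<^sup>2"
    by (simp add: power2_diff power_mult_distrib mult_ac)
  then show "1 / real (min CARD('a) CARD('b)) \<le> 64 * \<epsilon>\<^sup>2"
    by (simp add: \<delta>_def)
qed

theorem theorem3:
  fixes \<epsilon> :: real
  assumes "CARD('a::finite) \<ge> 2" and "CARD('b::finite) \<ge> 2"
    and "\<exists>(U :: complex ^ ('a \<times> 'b) ^ ('a \<times> 'b)) (b :: complex ^ 'b).
           approximate_masker \<epsilon> pure_states U b"
  shows "\<epsilon> \<ge> sqrt 2 / 72 * (- 1 + sqrt (1 + 36 / real (min (CARD('a)) (CARD('b)))))"
proof -
  define \<delta> where "\<delta> = 1 / real (min CARD('a) CARD('b))"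
  have \<epsilon>: "0 \<le> \<epsilon>" "\<delta> \<le> 64 * \<epsilon>\<^sup>2"
    unfolding \<delta>_def using assms(3) approximate_masker_dimension_bound[OF assms(1)] by blast+
  \<comment> \<open>The claim amounts to
    \<open>sqrt (1 + 36 * \<delta>) \<le> 1 + 36 * sqrt 2 * \<epsilon>\<close>. Its square holds
    since \<open>36 * 64 = 2304\<close> is below 2592, the coefficient of
    \<open>\<epsilon>\<^sup>2\<close> on the right.\<close>
  have "1 + 36 * \<delta> \<le> (1 + 36 * sqrt 2 * \<epsilon>)\<^sup>2"
  proof -
    have "0 \<le> \<epsilon>\<^sup>2" "0 \<le> sqrt 2 * \<epsilon>"
      using \<epsilon>(1) by simp_all
    moreover have "(1 + 36 * sqrt 2 * \<epsilon>)\<^sup>2 = 1 + 72 * (sqrt 2 * \<epsilon>) + 2592 * \<epsilon>\<^sup>2"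
      by (simp add: power2_sum power_mult_distrib)
    ultimately show ?thesis
      using \<epsilon>(2) by linarith
  qed
  then have "sqrt (1 + 36 * \<delta>) \<le> 1 + 36 * sqrt 2 * \<epsilon>"
    using \<epsilon>(1) by (intro real_le_lsqrt) simp_all
  then have "sqrt 2 / 72 * (- 1 + sqrt (1 + 36 * \<delta>)) \<le> sqrt 2 / 72 * (36 * sqrt 2 * \<epsilon>)"
    by (intro mult_left_mono) simp_all
  then show ?thesis
    by (simp add: \<delta>_def)
qed

end
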